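(* Let $\Omega$ be a bounded open set of $\mathbb{R}^N$ with Lipschitz boundary. Let $C\subseteq\mathbb{R}^{d\times N}$ be a convex Borel set with nonempty interior. Let $\mathcal{I},\overline{\mathcal{I}}:W^{1,\infty}(\Omega;\mathbb{R}^d)\to[0,+\infty]$ be the functionals $$\mathcal{I}(u):=\int_\Omega I_C(\nabla u)\,dx,\qquad \overline{\mathcal{I}}(u):=\int_\Omega I_{\overline C}(\nabla u)\,dx.$$ Then $$\overline{\mathcal{I}}(u)=\Gamma_{w*}(\mathcal{I})(u)=\Gamma_{w^*_{seq}}(\mathcal{I})(u)\qquad\text{for every }u\in W^{1,\infty}(\Omega;\mathbb{R}^d).$$
   Context: For a set $S\subseteq\mathbb{R}^{d\times N}$, $I_S:\mathbb{R}^{d\times N}\to[0,+\infty]$ is the indicator function: $I_S(\xi)=0$ if $\xi\in S$ and $I_S(\xi)=+\infty$ if $\xi\notin S$. $\overline C$ is the closure of $C$. $w^*$ denotes the weak* topology of $W^{1,\infty}(\Omega;\mathbb{R}^d)$ (i.e. the topology induced by the embedding $u\mapsto(u,\nabla u)$ into $L^\infty(\Omega;\mathbb{R}^d)\times L^\infty(\Omega;\mathbb{R}^{d\times N})$ endowed with its weak* topology), and $w^*_{seq}$ the associated sequential topology (the one whose closed sets are the sequentially weakly* closed sets). For a topology $\tau$ on a space $X$ and $F:X\to[-\infty,+\infty]$, $\Gamma_\tau(F):=\sup\{G\mid G:X\to[-\infty,+\infty]\ \tau\text{-lower semicontinuous},\ G\le F\text{ on }X\}$. Thus $\Gamma_{w*}(F)$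 is the greatest weakly* lower semicontinuous functional $\le F$, and $\Gamma_{w^*_{seq}}(F)$ is the greatest sequentially weakly* lower semicontinuous functional $\le F$. *)

theory Defs
  imports "HOL-Analysis.Analysis"
begin

section \<open>Bounded Lipschitz domains\<close>

text \<open>
  Near every boundary point the set is, after a rotation, the strict epigraph of a Lipschitz
  function. Here \<open>e\<close> is the unit vector of the last rotated coordinate, the remaining
  coordinates of \<open>y\<close> are its projection \<open>y - (y \<bullet> e) *\<^sub>R e\<close> onto the hyperplane orthogonal
  to \<open>e\<close>, and only the values of \<open>\<gamma>\<close> on that hyperplane matter.
\<close>

definition lipschitz_boundary :: "'a::euclidean_space set \<Rightarrow> bool" where
  "lipschitz_boundary \<Omega> \<longleftrightarrow>
     (\<forall>x\<in>frontier \<Omega>. \<exists>r>0. \<exists>e L. \<exists>\<gamma> :: 'a \<Rightarrow> real.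
        norm e = 1 \<and> L-lipschitz_on {z. z \<bullet> e = 0} \<gamma> \<and>
        \<Omega> \<inter> ball x r = {y \<in> ball x r. \<gamma> (y - (y \<bullet> e) *\<^sub>R e) < y \<bullet> e})"


section \<open>Smooth test functions\<close>

fun Ck :: "nat \<Rightarrow> ('a::euclidean_space \<Rightarrow> real) \<Rightarrow> bool" where
  "Ck 0 f \<longleftrightarrow> continuous_on UNIV f"
| "Ck (Suc k) f \<longleftrightarrow>
     (\<forall>x. f differentiable at x) \<and> (\<forall>b\<in>Basis. Ck k (\<lambda>x. frechet_derivative f (at x) b))"

definition test_functions :: "'a::euclidean_space set \<Rightarrow> ('a \<Rightarrow> real) set" where
  "test_functions \<Omega> =
     {\<phi>. (\<forall>k. Ck k \<phi>) \<and> compact (closure {x. \<phi> x \<noteq> 0}) \<and> closure {x. \<phi> x \<noteq> 0} \<subseteq> \<Omega>}"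


section \<open>Lebesgue and Sobolev spaces\<close>

text \<open>
  As usual in HOL-Analysis, elements of the function spaces are represented by functions on the
  whole space, and functions agreeing almost everywhere on \<open>\<Omega>\<close> are not identified. All topologies
  and functionals below depend only on the almost-everywhere class: functions in the same
  class are topologically indistinguishable, so (sequentially) closed sets are saturated and
  lower semicontinuous functionals are constant on classes.
\<close>

definition L1 :: "'a::euclidean_space set \<Rightarrow> ('a \<Rightarrow> 'b::euclidean_space) set" where
  "L1 \<Omega> = {f. integrable (lebesgue_on \<Omega>) f}"

definition Linf :: "'a::euclidean_space set \<Rightarrow> ('a \<Rightarrow> 'b::euclidean_space) set" where
  "Linf \<Omega> = {f \<in> borel_measurable (lebesgue_on \<Omega>). \<exists>M. AE x in lebesgue_on \<Omega>. norm (f x) \<le> M}"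

text \<open>
  The entry \<open>G x $ i $ j\<close> is the weak partial derivative of the \<open>i\<close>-th component of \<open>u\<close> in
  direction \<open>j\<close>; thus gradients are matrices with \<open>CARD('d)\<close> rows and \<open>CARD('n)\<close> columns.
\<close>

definition has_weak_gradient ::
    "(real^'n) set \<Rightarrow> (real^'n \<Rightarrow> real^'d) \<Rightarrow> (real^'n \<Rightarrow> real^'n^'d) \<Rightarrow> bool" where
  "has_weak_gradient \<Omega> u G \<longleftrightarrow>
     (\<forall>\<phi>\<in>test_functions \<Omega>. \<forall>i j.
        (LINT x|lebesgue_on \<Omega>. u x $ i * frechet_derivative \<phi> (at x) (axis j 1)) =
        - (LINT x|lebesgue_on \<Omega>. G x $ i $ j * \<phi> x))"

definition W1inf :: "(real^'n) set \<Rightarrow> (real^'n \<Rightarrow> real^'d) set" where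
  "W1inf \<Omega> = {u \<in> Linf \<Omega>. \<exists>G\<in>Linf \<Omega>. has_weak_gradient \<Omega> u G}"

text \<open>A representative of the weak gradient, which is unique up to null sets for open \<open>\<Omega>\<close>.\<close>

definition weak_grad ::
    "(real^'n) set \<Rightarrow> (real^'n \<Rightarrow> real^'d) \<Rightarrow> real^'n \<Rightarrow> real^'n^'d" where
  "weak_grad \<Omega> u = (SOME G. G \<in> Linf \<Omega> \<and> has_weak_gradient \<Omega> u G)"


section \<open>Weak* topologies\<close>

text \<open>
  The weak* topology of \<open>L\<^sup>\<infinity> = (L\<^sup>1)*\<close>: the coarsest topology making all pairings with
  integrable functions continuous.
\<close>

definition weak_star_Linf ::
    "'a::euclidean_space set \<Rightarrow> ('a \<Rightarrow> 'b::euclidean_space) topology" where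
  "weak_star_Linf \<Omega> =
     pullback_topology (Linf \<Omega>) (\<lambda>f. \<lambda>g\<in>L1 \<Omega>. LINT x|lebesgue_on \<Omega>. f x \<bullet> g x)
       (product_topology (\<lambda>_. euclideanreal) (L1 \<Omega>))"

definition weak_star_W1inf :: "(real^'n) set \<Rightarrow> (real^'n \<Rightarrow> real^'d) topology" where
  "weak_star_W1inf \<Omega> =
     pullback_topology (W1inf \<Omega>) (\<lambda>u. (u, weak_grad \<Omega> u))
       (prod_topology (weak_star_Linf \<Omega>) (weak_star_Linf \<Omega>))"

definition sequentially_closedin :: "'a topology \<Rightarrow> 'a set \<Rightarrow> bool" where
  "sequentially_closedin T S \<longleftrightarrow>
     S \<subseteq> topspace T \<and> (\<forall>\<sigma> l. range \<sigma> \<subseteq> S \<and> limitin T \<sigma> l sequentially \<longrightarrow> l \<in> S)"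

definition sequential_topology :: "'a topology \<Rightarrow> 'a topology" where
  "sequential_topology T =
     topology (\<lambda>U. U \<subseteq> topspace T \<and> sequentially_closedin T (topspace T - U))"

lemma sequentially_closedinD:
  assumes "sequentially_closedin T S" "\<And>n. \<sigma> n \<in> S" "limitin T \<sigma> l sequentially"
  shows "l \<in> S"
proof -
  have "range \<sigma> \<subseteq> S" by (rule image_subsetI) (rule assms(2))
  with assms(1,3) show ?thesis unfolding sequentially_closedin_def by metis
qed

lemma istopology_sequential:
  "istopology (\<lambda>U. U \<subseteq> topspace T \<and> sequentially_closedin T (topspace T - U))"
  unfolding istopology_def
proof (intro conjI allI impI)
  fix S U
  assume S: "S \<subseteq> topspace T \<and> sequentially_closedin T (topspace T - S)"
    and U: "U \<subseteq> topspace T \<and> sequentially_closedin T (topspace T - U)"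
  show "S \<inter> U \<subseteq> topspace T" using S by blast
  show "sequentially_closedin T (topspace T - S \<inter> U)"
    unfolding sequentially_closedin_def
  proof (intro conjI allI impI)
    fix \<sigma> :: "nat \<Rightarrow> 'a" and l
    assume *: "range \<sigma> \<subseteq> topspace T - S \<inter> U \<and> limitin T \<sigma> l sequentially"
    have mem: "\<sigma> n \<in> topspace T - S \<inter> U" for n
      by (rule subsetD[OF conjunct1[OF *] rangeI])
    have lim: "limitin T \<sigma> l sequentially"
      by (rule conjunct2[OF *])
    then have l: "l \<in> topspace T" by (simp add: limitin_def)
    have key: "l \<notin> V" if V: "sequentially_closedin T (topspace T - V)"
      and inf: "infinite {n. \<sigma> n \<notin> V}" for V
    proof -
      obtain r :: "nat \<Rightarrow> nat" where r: "strict_mono r" "\<And>n. r n \<in> {n. \<sigma> n \<notin> V}"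
        using infinite_enumerate[OF inf] by blast
      have "limitin T (\<sigma> \<circ> r) l sequentially"
        by (rule limitin_subsequence[OF r(1) lim])
      moreover have "(\<sigma> \<circ> r) n \<in> topspace T - V" for n
      proof -
        from r(2)[of n] mem[of "r n"] show ?thesis by simp
      qed
      ultimately have "l \<in> topspace T - V"
        using sequentially_closedinD[OF V, of "\<sigma> \<circ> r" l] by simp
      then show ?thesis by simp
    qed
    have "{n. \<sigma> n \<notin> S} \<union> {n. \<sigma> n \<notin> U} = UNIV" using mem by auto
    then have "infinite {n. \<sigma> n \<notin> S} \<or> infinite {n. \<sigma> n \<notin> U}"
      by (metis finite_Un infinite_UNIV_nat)
    then have "l \<notin> S \<or> l \<notin> U"
      using key[of S] key[of U] S U by argo
    with l show "l \<in> topspace T - S \<inter> U" by blast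
  qed auto
next
  fix K
  assume K: "\<forall>U\<in>K. U \<subseteq> topspace T \<and> sequentially_closedin T (topspace T - U)"
  then show "\<Union>K \<subseteq> topspace T" by blast
  show "sequentially_closedin T (topspace T - \<Union>K)"
    unfolding sequentially_closedin_def
  proof (intro conjI allI impI)
    fix \<sigma> :: "nat \<Rightarrow> 'a" and l
    assume *: "range \<sigma> \<subseteq> topspace T - \<Union>K \<and> limitin T \<sigma> l sequentially"
    have mem: "\<sigma> n \<in> topspace T - \<Union>K" for n
      by (rule subsetD[OF conjunct1[OF *] rangeI])
    have lim: "limitin T \<sigma> l sequentially"
      by (rule conjunct2[OF *])
    then have l: "l \<in> topspace T" by (simp add: limitin_def)
    have "l \<notin> U" if "U \<in> K" for U
    proof -
      have "\<sigma> n \<in> topspace T - U" for n using mem[of n] that by blast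
      moreover have "sequentially_closedin T (topspace T - U)" using K that by blast
      ultimately have "l \<in> topspace T - U"
        using sequentially_closedinD[of T "topspace T - U" \<sigma> l] lim by blast
      then show ?thesis by simp
    qed
    with l show "l \<in> topspace T - \<Union>K" by blast
  qed auto
qed

lemma openin_sequential_topology:
  "openin (sequential_topology T) U \<longleftrightarrow>
     U \<subseteq> topspace T \<and> sequentially_closedin T (topspace T - U)"
  by (simp add: sequential_topology_def topology_inverse'[OF istopology_sequential])

lemma topspace_sequential_topology [simp]: "topspace (sequential_topology T) = topspace T"
proof
  show "topspace (sequential_topology T) \<subseteq> topspace T"
    using openin_topspace[of "sequential_topology T"] unfolding openin_sequential_topology
    by (rule conjunct1)
  show "topspace T \<subseteq> topspace (sequential_topology T)"
    by (rule openin_subset) (simp add: openin_sequential_topology sequentially_closedin_def)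
qed

lemma closedin_sequential_topology:
  "closedin (sequential_topology T) S \<longleftrightarrow> sequentially_closedin T S"
proof (cases "S \<subseteq> topspace T")
  case True
  then have "topspace T - (topspace T - S) = S" by blast
  with True show ?thesis by (simp add: closedin_def openin_sequential_topology)
next
  case False
  then show ?thesis by (simp add: closedin_def sequentially_closedin_def)
qed


section \<open>Semicontinuous envelopes\<close>

definition lsc_on_topology :: "'a topology \<Rightarrow> ('a \<Rightarrow> ereal) \<Rightarrow> bool" where
  "lsc_on_topology T G \<longleftrightarrow> (\<forall>a. openin T {x \<in> topspace T. a < G x})"

definition Gamma_env :: "'a topology \<Rightarrow> ('a \<Rightarrow> ereal) \<Rightarrow> 'a \<Rightarrow> ereal" where
  "Gamma_env T F u =
     (SUP G \<in> {G. lsc_on_topology T G \<and> (\<forall>v\<in>topspace T. G v \<le> F v)}. G u)"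


section \<open>The unbounded integral functionals\<close>

definition indicator_inf :: "'a set \<Rightarrow> 'a \<Rightarrow> ennreal" where
  "indicator_inf S \<xi> = (if \<xi> \<in> S then 0 else \<infinity>)"

definition constraint_functional ::
    "(real^'n) set \<Rightarrow> (real^'n^'d) set \<Rightarrow> (real^'n \<Rightarrow> real^'d) \<Rightarrow> ereal" where
  "constraint_functional \<Omega> C u =
     enn2ereal (\<integral>\<^sup>+ x. indicator_inf C (weak_grad \<Omega> u x) \<partial>lebesgue_on \<Omega>)"

end

theory Submission
  imports Defs
begin

text \<open>
  The constraint \<open>\<nabla>u \<in> closure C\<close> a.e. means that all averages of \<open>\<nabla>u\<close> lie in the half-spaces
  containing \<open>C\<close>, which is a weak* closed condition; hence the functional of \<open>closure C\<close> is weakly*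
  lower semicontinuous and lies below both envelopes. Conversely, if \<open>\<nabla>u \<in> closure C\<close> a.e. and \<open>A\<close> is
  interior to \<open>C\<close>, then \<open>(1 - t) u + t A x\<close> has its gradient in \<open>interior C\<close> for \<open>0 < t \<le> 1\<close> and tends
  to \<open>u\<close> as \<open>t \<rightarrow> 0\<close>, so no sequentially lower semicontinuous minorant is positive at \<open>u\<close>.
  As \<open>weak_grad\<close> is an arbitrary choice, the gradient of the perturbation is only known through
  uniqueness of weak gradients. For this, the functions \<open>exp (- 1 / t) / t ^ m\<close> generate an algebra
  closed under partial derivatives, and it contains test functions increasing to indicators of boxes.
\<close>

section \<open>Smooth functions built from \<open>exp (- (1 / t))\<close>\<close>

text \<open>The classical smooth function that is flat at 0. The powers of \<open>1 / t\<close> are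
  included because differentiating produces them, so that the whole family over \<open>m\<close> is
  closed under derivatives up to linear combinations.\<close>

definition flat :: "nat \<Rightarrow> real \<Rightarrow> real" where
  "flat m t = (if t > 0 then exp (- (1 / t)) / t ^ m else 0)"

text \<open>From the right, the substitution \<open>s = 1 / t\<close> gives
  \<open>s ^ m / exp s\<close>, where the exponential wins as s tends to infinity.\<close>

lemma flat_tendsto_0: "(flat m \<longlongrightarrow> 0) (at 0)"
proof -
  have "((\<lambda>t::real. (inverse t) ^ m / exp (inverse t)) \<longlongrightarrow> 0) (at_right 0)"
    by (rule filterlim_compose[OF tendsto_power_div_exp_0 filterlim_inverse_at_top_right])
  then have R: "(flat m \<longlongrightarrow> 0) (at_right 0)"
  proof (rule Lim_transform_eventually)
    show "\<forall>\<^sub>F t in at_right 0. (inverse t) ^ m / exp (inverse t) = flat m t"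
      using eventually_at_right_less[of "0::real"]
      by eventually_elim (simp add: flat_def exp_minus field_simps)
  qed
  have L: "(flat m \<longlongrightarrow> 0) (at_left 0)"
  proof (rule Lim_transform_eventually[OF tendsto_const])
    show "\<forall>\<^sub>F t in at_left 0. 0 = flat m t"
      by (simp add: eventually_at_filter flat_def)
  qed
  show ?thesis using L R by (simp add: filterlim_at_split)
qed

lemma DERIV_flat:
  "(flat m has_real_derivative (flat (m + 2) t - real m * flat (m + 1) t)) (at t)"
proof -
  consider "t < 0" | "t = 0" | "t > 0" by linarith
  then show ?thesis
  proof cases
    case 1
    have "((\<lambda>_. 0) has_real_derivative 0) (at t)" by simp
    then have "(flat m has_real_derivative 0) (at t)"
      by (rule has_field_derivative_transform_within_open[of _ _ _ "{..<0}"])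
        (use 1 in \<open>auto simp: flat_def\<close>)
    with 1 show ?thesis by (simp add: flat_def)
  next
    case 2
    \<comment> \<open>The difference quotient of \<open>flat m\<close> at 0 is
      \<open>flat (Suc m)\<close>, so its limit is already known.\<close>
    have "((\<lambda>h. (flat m (0 + h) - flat m 0) / h) \<longlongrightarrow> 0) (at 0)"
      by (rule Lim_transform_eventually[OF flat_tendsto_0[of "Suc m"]])
        (auto simp: flat_def eventually_at_filter)
    with 2 show ?thesis by (simp add: DERIV_def flat_def)
  next
    case 3
    \<comment> \<open>Quotient rule. The truncated exponent \<open>m - 1\<close> is harmless for
      \<open>m = 0\<close>, since the factor \<open>real m\<close> then vanishes.\<close>
    have "((\<lambda>s. exp (- (1 / s)) / s ^ m) has_real_derivative
        (exp (- (1 / t)) * (1 / t\<^sup>2) * t ^ m - exp (- (1 / t)) * (real m * t ^ (m - 1))) / (t ^ m * t ^ m)) (at t)"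
      using 3 by (auto intro!: derivative_eq_intros simp: power2_eq_square)
    moreover have "(exp (- (1 / t)) * (1 / t\<^sup>2) * t ^ m - exp (- (1 / t)) * (real m * t ^ (m - 1))) / (t ^ m * t ^ m)
       = flat (m + 2) t - real m * flat (m + 1) t"
      using 3 by (cases m) (auto simp: flat_def field_simps power2_eq_square)
    ultimately have "((\<lambda>s. exp (- (1 / s)) / s ^ m) has_real_derivative
        flat (m + 2) t - real m * flat (m + 1) t) (at t)" by simp
    then show ?thesis
      by (rule has_field_derivative_transform_within_open[of _ _ _ "{0<..}"])
        (use 3 in \<open>auto simp: flat_def\<close>)
  qed
qed

text \<open>The arguments of the generators are affine in \<open>x\<close>, so the chain rule only
  contributes the constant factor \<open>b \<bullet> v\<close> and partial derivatives stay in the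
  algebra.\<close>

inductive flat_algebra :: "('a::euclidean_space \<Rightarrow> real) \<Rightarrow> bool" where
  const: "flat_algebra (\<lambda>x. c)"
| flat: "flat_algebra (\<lambda>x. flat m (x \<bullet> v + d))"
| add: "flat_algebra f \<Longrightarrow> flat_algebra g \<Longrightarrow> flat_algebra (\<lambda>x. f x + g x)"
| mult: "flat_algebra f \<Longrightarrow> flat_algebra g \<Longrightarrow> flat_algebra (\<lambda>x. f x * g x)"

lemma flat_algebra_prod:
  assumes "finite I" "\<And>i. i \<in> I \<Longrightarrow> flat_algebra (f i)"
  shows "flat_algebra (\<lambda>x. \<Prod>i\<in>I. f i x)"
  using assms
proof (induction I rule: finite_induct)
  case empty
  show ?case by (simp add: flat_algebra.const)
next
  case (insert i I)
  then have "flat_algebra (\<lambda>x. f i x * (\<Prod>i\<in>I. f i x))"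
    by (intro flat_algebra.mult) auto
  with insert.hyps show ?case by simp
qed

text \<open>Induction over the generation of \<open>f\<close>: \<open>DERIV_flat\<close> with the
  chain rule for the generators, then the sum and product rules. Membership of each directional
  derivative is part of the claim so that differentiation can be iterated.\<close>

lemma flat_algebra_derivative:
  assumes "flat_algebra f"
  shows "\<exists>D. \<forall>x. (f has_derivative D x) (at x) \<and> (\<forall>b. flat_algebra (\<lambda>x. D x b))"
  using assms
proof induction
  case (const c)
  show ?case
    by (rule exI[of _ "\<lambda>x b. 0"]) (simp add: flat_algebra.const)
next
  case (flat m v d)
  let ?D = "\<lambda>x b. (flat (m + 2) (x \<bullet> v + d) + (- real m) * flat (m + 1) (x \<bullet> v + d)) * (b \<bullet> v)"
  have "((\<lambda>x. flat m (x \<bullet> v + d)) has_derivative ?D x) (at x)" for x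
  proof -
    have "(flat m has_derivative (\<lambda>h. (flat (m + 2) (x \<bullet> v + d) + (- real m) * flat (m + 1) (x \<bullet> v + d)) * h))
        (at (x \<bullet> v + d))"
      using DERIV_flat[of m "x \<bullet> v + d"] by (simp add: has_field_derivative_def)
    moreover have "((\<lambda>x. x \<bullet> v + d) has_derivative (\<lambda>b. b \<bullet> v)) (at x)"
      by (auto intro!: derivative_eq_intros)
    ultimately show ?thesis by (rule has_derivative_compose[rotated])
  qed
  moreover have "flat_algebra (\<lambda>x. ?D x b)" for b
    by (rule flat_algebra.mult[OF flat_algebra.add[OF flat_algebra.flat
          flat_algebra.mult[OF flat_algebra.const flat_algebra.flat]] flat_algebra.const])
  ultimately show ?case by (intro exI[of _ ?D] allI conjI)
next
  case (add f g)
  then obtain D E where D: "\<And>x. (f has_derivative D x) (at x)" "\<And>b. flat_algebra (\<lambda>x. D x b)"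
    and E: "\<And>x. (g has_derivative E x) (at x)" "\<And>b. flat_algebra (\<lambda>x. E x b)" by blast
  show ?case
    using has_derivative_add[OF D(1) E(1)] flat_algebra.add[OF D(2) E(2)]
    by (intro exI[of _ "\<lambda>x b. D x b + E x b"] allI conjI)
next
  case (mult f g)
  then obtain D E where D: "\<And>x. (f has_derivative D x) (at x)" "\<And>b. flat_algebra (\<lambda>x. D x b)"
    and E: "\<And>x. (g has_derivative E x) (at x)" "\<And>b. flat_algebra (\<lambda>x. E x b)" by blast
  have "flat_algebra (\<lambda>x. f x * E x b + D x b * g x)" for b
    using flat_algebra.add[OF flat_algebra.mult[OF mult.hyps(1) E(2)] flat_algebra.mult[OF D(2) mult.hyps(2)]] .
  then show ?case
    using has_derivative_mult[OF D(1) E(1)] by (intro exI[of _ "\<lambda>x b. f x * E x b + D x b * g x"] allI conjI)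
qed

text \<open>Each partial derivative is again in the algebra, so the induction on \<open>k\<close>
  runs with \<open>f\<close> arbitrary.\<close>

lemma flat_algebra_Ck: "flat_algebra f \<Longrightarrow> Ck k f"
proof (induction k arbitrary: f)
  case 0
  obtain D where "\<forall>x. (f has_derivative D x) (at x) \<and> (\<forall>b. flat_algebra (\<lambda>x. D x b))"
    using flat_algebra_derivative[OF 0] ..
  then have "(f has_derivative D x) (at x)" for x by simp
  then have "continuous_on UNIV f"
    by (rule has_derivative_continuous_on)
  then show ?case by simp
next
  case (Suc k)
  obtain D where D: "\<forall>x. (f has_derivative D x) (at x) \<and> (\<forall>b. flat_algebra (\<lambda>x. D x b))"
    using flat_algebra_derivative[OF Suc.prems] ..
  then have D: "(f has_derivative D x) (at x)" "flat_algebra (\<lambda>x. D x b)" for x b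
    by simp_all
  have "frechet_derivative f (at x) = D x" for x
    using frechet_derivative_at[OF D(1)[of x]] by simp
  moreover have "f differentiable at x" for x
    using D(1)[of x] unfolding differentiable_def by blast
  moreover have "Ck k (\<lambda>x. D x b)" for b
    by (rule Suc.IH[OF D(2)])
  ultimately show ?case by simp
qed

section \<open>Test functions approximating indicators of boxes\<close>

text \<open>The dilation by \<open>Suc k\<close> does not change where the product is positive,
  namely on \<open>box a b\<close>, but pushes each factor there to \<open>exp 0 = 1\<close> as
  \<open>k\<close> grows. The successor keeps the dilation positive at \<open>k = 0\<close>.\<close>

definition box_bump :: "'a::euclidean_space \<Rightarrow> 'a \<Rightarrow> nat \<Rightarrow> 'a \<Rightarrow> real" where
  "box_bump a b k x =
     (\<Prod>i\<in>Basis. flat 0 (real (Suc k) * (x \<bullet> i - a \<bullet> i)) * flat 0 (real (Suc k) * (b \<bullet> i - x \<bullet> i)))"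

lemma flat_0_bounds: "0 \<le> flat 0 t" "flat 0 t \<le> 1"
  by (auto simp: flat_def)

lemma flat_0_eq_0_iff: "flat 0 t = 0 \<longleftrightarrow> t \<le> 0"
  by (auto simp: flat_def)

lemma box_bump_eq_0_iff: "box_bump a b k x = 0 \<longleftrightarrow> x \<notin> box a b"
  by (auto simp: box_bump_def flat_0_eq_0_iff mem_box mult_le_0_iff not_less)

lemma box_bump_bounds: "0 \<le> box_bump a b k x" "box_bump a b k x \<le> 1"
  unfolding box_bump_def
  by (intro prod_nonneg prod_le_1 ballI conjI mult_le_one mult_nonneg_nonneg flat_0_bounds)+

lemma box_bump_test_function:
  assumes "cbox a b \<subseteq> \<Omega>"
  shows "box_bump a b k \<in> test_functions \<Omega>"
proof -
  \<comment> \<open>The dilation is absorbed into the affine argument: \<open>c *\<^sub>R i\<close>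
    is the direction and \<open>- c * d\<close> the offset, with signs reversed for the other
    face.\<close>
  have *: "flat_algebra (\<lambda>x. flat 0 (c * (x \<bullet> i - d)))" "flat_algebra (\<lambda>x. flat 0 (c * (d - x \<bullet> i)))"
    for c d and i :: 'a
    using flat_algebra.flat[of 0 "c *\<^sub>R i" "- c * d"] flat_algebra.flat[of 0 "- c *\<^sub>R i" "c * d"]
    by (simp_all add: algebra_simps)
  have "flat_algebra (box_bump a b k)"
    unfolding box_bump_def by (rule flat_algebra_prod[OF finite_Basis flat_algebra.mult[OF *]])
  then have Ck: "\<forall>k'. Ck k' (box_bump a b k)" by (intro allI flat_algebra_Ck)
  have sub: "closure {x. box_bump a b k x \<noteq> 0} \<subseteq> cbox a b"
    by (rule closure_minimal) (use box_subset_cbox[of a b] in \<open>auto simp: box_bump_eq_0_iff\<close>)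
  then have "compact (closure {x. box_bump a b k x \<noteq> 0})"
    using bounded_subset[OF bounded_cbox] compact_eq_bounded_closed by blast
  with Ck subset_trans[OF sub assms] show ?thesis
    unfolding test_functions_def by (intro CollectI conjI)
qed

lemma box_bump_tendsto: "(\<lambda>k. box_bump a b k x) \<longlonglongrightarrow> indicat_real (box a b) x"
proof (cases "x \<in> box a b")
  case False
  then have "box_bump a b k x = 0" for k by (simp add: box_bump_eq_0_iff)
  with False show ?thesis by simp
next
  case True
  have *: "(\<lambda>k. flat 0 (real (Suc k) * t)) \<longlonglongrightarrow> 1" if "t > 0" for t
  proof -
    have "(\<lambda>k. exp (- (inverse (real (Suc k)) * (1 / t)))) \<longlonglongrightarrow> exp (- (0 * (1 / t)))"
      by (intro tendsto_intros LIMSEQ_inverse_real_of_nat)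
    with that show ?thesis by (simp add: flat_def inverse_eq_divide)
  qed
  have "(\<lambda>k. box_bump a b k x) \<longlonglongrightarrow> (\<Prod>i\<in>(Basis::'a set). 1 * 1)"
    unfolding box_bump_def
    by (intro tendsto_prod tendsto_mult *) (use True in \<open>auto simp: mem_box\<close>)
  with True show ?thesis by simp
qed

section \<open>The fundamental lemma of the calculus of variations\<close>

lemma Int_stable_box: "Int_stable (range (\<lambda>(a, b). box a b :: 'a::euclidean_space set))"
  by (rule Int_stableI) (auto simp: box_Int_box image_iff, blast)

text \<open>Dynkin's argument: boxes form an intersection-stable generator of the Borel sets, and
  the sets over which \<open>h\<close> integrates to 0 are closed under complements and countable
  disjoint unions. A function whose integral over every Borel set is 0 vanishes almost
  everywhere.\<close>

lemma AE_lborel_eq_0_if_box_integrals_eq_0: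
  fixes h :: "'a::euclidean_space \<Rightarrow> real"
  assumes int: "integrable lborel h"
    and box: "\<And>a b. (LINT x:box a b|lborel. h x) = 0"
  shows "AE x in lborel. h x = 0"
proof (rule sigma_finite_measure.density_zero[OF sigma_finite_lborel int])
  have h_on: "set_integrable lborel B h" if "B \<in> sets borel" for B
    unfolding set_integrable_def using that int by (intro integrable_mult_indicator) auto
  \<comment> \<open>The complement step needs the integral over the whole space, obtained by
    exhausting it with growing boxes.\<close>
  have UNIV: "(LINT x:UNIV|lborel. h x) = 0"
  proof -
    have "(\<lambda>n. LINT x:box (- real n *\<^sub>R One) (real n *\<^sub>R One)|lborel. h x)
        \<longlonglongrightarrow> (LINT x:(\<Union>n. box (- real n *\<^sub>R One) (real n *\<^sub>R One))|lborel. h x)"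
    proof (rule set_integral_cont_up)
      show "incseq (\<lambda>n. box (- real n *\<^sub>R One) (real n *\<^sub>R (One::'a)))"
        by (intro monoI subset_box_imp) (auto simp: inner_simps)
      show "set_integrable lborel (\<Union>n. box (- real n *\<^sub>R One) (real n *\<^sub>R One)) h"
        by (intro h_on) auto
    qed simp
    moreover have "(\<Union>n. box (- real n *\<^sub>R One) (real n *\<^sub>R One)) = (UNIV :: 'a set)"
      using UN_box_eq_UNIV[where 'a = 'a] by simp
    ultimately show ?thesis unfolding box by (simp add: LIMSEQ_const_iff)
  qed
  fix B :: "'a set"
  assume "B \<in> sets lborel"
  then have B: "B \<in> sigma_sets UNIV (range (\<lambda>(a, b). box a b :: 'a set))"
    by (simp add: borel_eq_box)
  have boxes: "range (\<lambda>(a, b). box a b :: 'a set) \<subseteq> Pow UNIV" by simp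
  from Int_stable_box boxes B show "(LINT x:B|lborel. h x) = 0"
  proof (induction B rule: sigma_sets_induct_disjoint)
    case (basic A)
    then show ?case using box by auto
  next
    case empty
    show ?case by (simp add: set_lebesgue_integral_def)
  next
    case (compl A)
    then have A: "A \<in> sets borel" by (simp add: borel_eq_box)
    have "(LINT x:A \<union> (UNIV - A)|lborel. h x) = (LINT x:A|lborel. h x) + (LINT x:UNIV - A|lborel. h x)"
      by (rule set_integral_Un) (use A in \<open>auto intro: h_on\<close>)
    with compl.IH UNIV show ?case by simp
  next
    case (union A)
    then have "range A \<subseteq> sets borel" by (simp add: borel_eq_box)
    then have A: "A i \<in> sets borel" for i by auto
    have "(LINT x:(\<Union>i. A i)|lborel. h x) = (\<Sum>i. LINT x:A i|lborel. h x)"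
      by (rule lebesgue_integral_countable_add)
        (use A union.hyps(1) in \<open>auto intro!: h_on simp: disjoint_family_on_def\<close>)
    with union.IH show ?case by simp
  qed
qed

text \<open>Localization to a box inside \<Omega>: the truncation of \<open>f\<close> to it has
  vanishing integral over every box, because the intersection of two boxes is a box. Countably many
  closed boxes then cover \<Omega>.\<close>

lemma AE_lebesgue_on_eq_0_if_box_integrals_eq_0:
  fixes f :: "'a::euclidean_space \<Rightarrow> real"
  assumes \<Omega>: "open \<Omega>" and int: "integrable (lebesgue_on \<Omega>) f"
    and box: "\<And>a b. cbox a b \<subseteq> \<Omega> \<Longrightarrow> (LINT x|lebesgue_on \<Omega>. indicat_real (box a b) x * f x) = 0"
  shows "AE x in lebesgue_on \<Omega>. f x = 0"
proof -
  have \<Omega>_sets: "\<Omega> \<inter> space lebesgue \<in> sets lebesgue" using \<Omega> by auto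
  have int': "integrable lebesgue (\<lambda>x. indicat_real \<Omega> x * f x)"
    using int unfolding integrable_restrict_space[OF \<Omega>_sets] by simp
  have box': "(LINT x|lebesgue. indicat_real (box a b) x * f x) = 0" if "cbox a b \<subseteq> \<Omega>" for a b
  proof -
    have "indicat_real \<Omega> x * (indicat_real (box a b) x * f x) = indicat_real (box a b) x * f x" for x
      using that box_subset_cbox[of a b] by (auto simp: indicator_def)
    with box[OF that] show ?thesis unfolding integral_restrict_space[OF \<Omega>_sets] by simp
  qed
  have on_box: "AE x in lebesgue. x \<in> cbox a b \<longrightarrow> f x = 0" if ab: "cbox a b \<subseteq> \<Omega>" for a b
  proof -
    define g where "g x = indicat_real (box a b) x * f x" for x
    have g_eq: "g = (\<lambda>x. indicat_real (box a b) x *\<^sub>R (indicat_real \<Omega> x * f x))"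
      using that box_subset_cbox[of a b] by (intro ext) (auto simp: indicator_def g_def)
    have g: "integrable lebesgue g"
      unfolding g_eq by (rule integrable_mult_indicator[OF _ int']) simp
    \<comment> \<open>A Borel representative is needed because the criterion above is about
      \<open>lborel\<close>, while \<open>g\<close> is only Lebesgue measurable.\<close>
    then obtain h where h [measurable]: "h \<in> borel_measurable lborel" and gh: "AE x in lborel. g x = h x"
      using completion_ex_borel_measurable_real[of g lborel] by auto
    have gh': "AE x in lebesgue. g x = h x" by (rule AE_completion[OF gh])
    have hm: "h \<in> borel_measurable lebesgue" using h by (simp add: measurable_completion)
    have "integrable lebesgue h" by (rule integrable_cong_AE_imp[OF g hm gh'])
    then have "integrable lborel h" using h by (simp add: integrable_completion)
    moreover have "(LINT x:box c d|lborel. h x) = 0" for c d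
    proof -
      \<comment> \<open>The corners of the intersection of \<open>box a b\<close> and
        \<open>box c d\<close>.\<close>
      let ?c = "\<Sum>i\<in>Basis. max (a\<bullet>i) (c\<bullet>i) *\<^sub>R i" and ?d = "\<Sum>i\<in>Basis. min (b\<bullet>i) (d\<bullet>i) *\<^sub>R i"
      have "(LINT x:box c d|lborel. h x) = (LINT x|lebesgue. indicat_real (box c d) x * h x)"
        unfolding set_lebesgue_integral_def by (simp add: integral_completion)
      also have "\<dots> = (LINT x|lebesgue. indicat_real (box c d) x * g x)"
      proof (rule integral_cong_AE)
        show "AE x in lebesgue. indicat_real (box c d) x * h x = indicat_real (box c d) x * g x"
          using gh' by eventually_elim simp
        have "indicat_real (box c d) \<in> borel_measurable lebesgue"
          by (rule borel_measurable_indicator) simp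
        from borel_measurable_times[OF this hm]
          borel_measurable_times[OF this borel_measurable_integrable[OF g]]
        show "(\<lambda>x. indicat_real (box c d) x * h x) \<in> borel_measurable lebesgue"
          "(\<lambda>x. indicat_real (box c d) x * g x) \<in> borel_measurable lebesgue" .
      qed
      also have "\<dots> = (LINT x|lebesgue. indicat_real (box ?c ?d) x * f x)"
        unfolding box_Int_box[symmetric] g_def
        by (intro Bochner_Integration.integral_cong) (auto simp: indicator_def)
      also have "\<dots> = 0"
      proof (rule box')
        have "cbox ?c ?d = cbox a b \<inter> cbox c d" by (rule Int_interval[symmetric])
        with ab show "cbox ?c ?d \<subseteq> \<Omega>" by blast
      qed
      finally show ?thesis .
    qed
    ultimately have "AE x in lebesgue. h x = 0"
      by (rule AE_completion[OF AE_lborel_eq_0_if_box_integrals_eq_0])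
    \<comment> \<open>On the faces of the box \<open>g\<close> is 0 by truncation and says nothing
      about \<open>f\<close>, so they are discarded as a null set.\<close>
    moreover have "AE x in lebesgue. x \<notin> cbox a b - box a b"
      using negligible_frontier_interval[of a b] unfolding negligible_iff_null_sets by (rule AE_not_in)
    ultimately show ?thesis
      using gh' by eventually_elim (auto simp: g_def)
  qed
  obtain \<D> where \<D>: "countable \<D>" "\<And>X. X \<in> \<D> \<Longrightarrow> \<exists>a b. X = cbox a b" and \<D>_Un: "\<Union>\<D> = \<Omega>"
    using open_countable_Union_open_cbox[OF \<Omega>] by metis
  have "AE x in lebesgue. \<forall>X\<in>\<D>. x \<in> X \<longrightarrow> f x = 0"
    unfolding AE_ball_countable[OF \<D>(1)]
  proof
    fix X
    assume X: "X \<in> \<D>"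
    from \<D>(2)[OF X] obtain a b where "X = cbox a b" by blast
    with on_box[of a b] Union_upper[OF X, unfolded \<D>_Un] show "AE x in lebesgue. x \<in> X \<longrightarrow> f x = 0" by simp
  qed
  then have "AE x in lebesgue. x \<in> \<Omega> \<longrightarrow> f x = 0"
    by (rule eventually_mono) (use \<D>_Un in blast)
  then show ?thesis by (simp add: AE_restrict_space_iff[OF \<Omega>_sets])
qed

text \<open>Testing with the bumps of a box and letting \<open>k\<close> tend to infinity gives the
  integral of \<open>f\<close> over that box. Since bumps take values between 0 and 1,
  \<open>norm (f x)\<close> dominates.\<close>

lemma fundamental_lemma_calculus_of_variations:
  fixes f :: "'a::euclidean_space \<Rightarrow> real"
  assumes "open \<Omega>" and int: "integrable (lebesgue_on \<Omega>) f"
    and test: "\<And>\<phi>. \<phi> \<in> test_functions \<Omega> \<Longrightarrow> (LINT x|lebesgue_on \<Omega>. f x * \<phi> x) = 0"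
  shows "AE x in lebesgue_on \<Omega>. f x = 0"
proof (rule AE_lebesgue_on_eq_0_if_box_integrals_eq_0[OF assms(1,2)])
  fix a b
  assume ab: "cbox a b \<subseteq> \<Omega>"
  have meas: "box_bump a b k \<in> borel_measurable (lebesgue_on \<Omega>)" for k
  proof -
    have "Ck 0 (box_bump a b k)"
      using box_bump_test_function[OF ab, of k] unfolding test_functions_def by blast
    then have "box_bump a b k \<in> borel_measurable lebesgue"
      by (simp add: borel_measurable_continuous_onI measurable_completion)
    then show ?thesis by (rule measurable_restrict_space1)
  qed
  have "(\<lambda>k. LINT x|lebesgue_on \<Omega>. f x * box_bump a b k x)
      \<longlonglongrightarrow> (LINT x|lebesgue_on \<Omega>. indicat_real (box a b) x * f x)"
  proof (rule integral_dominated_convergence[where w = "\<lambda>x. norm (f x)"])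
    show "(\<lambda>x. indicat_real (box a b) x * f x) \<in> borel_measurable (lebesgue_on \<Omega>)"
      using int by (intro borel_measurable_times borel_measurable_indicator)
        (auto simp: borel_measurable_integrable sets_restrict_space image_iff intro!: bexI[of _ "box a b"]
            dest: subsetD[OF subset_trans[OF box_subset_cbox ab]])
    show "AE x in lebesgue_on \<Omega>. (\<lambda>k. f x * box_bump a b k x) \<longlonglongrightarrow> indicat_real (box a b) x * f x"
      by (subst mult.commute) (intro AE_I2 tendsto_mult box_bump_tendsto tendsto_const)
    show "AE x in lebesgue_on \<Omega>. norm (f x * box_bump a b k x) \<le> norm (f x)" for k
      by (intro AE_I2) (simp add: abs_mult abs_of_nonneg[OF box_bump_bounds(1)] mult_left_le box_bump_bounds)
  qed (use int meas in \<open>auto simp: borel_measurable_integrable\<close>)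
  then show "(LINT x|lebesgue_on \<Omega>. indicat_real (box a b) x * f x) = 0"
    unfolding test[OF box_bump_test_function[OF ab]] by (simp add: LIMSEQ_const_iff)
qed

section \<open>Integrals of derivatives of compactly supported functions\<close>

lemma integrable_continuous_compact_support:
  fixes g :: "'a::euclidean_space \<Rightarrow> 'b::euclidean_space"
  assumes "continuous_on UNIV g" "compact K" "\<And>x. x \<notin> K \<Longrightarrow> g x = 0"
  shows "integrable lborel g"
proof -
  have "(\<lambda>x. indicator K x *\<^sub>R g x) = g"
    using assms(3) by (auto simp: indicator_def fun_eq_iff)
  moreover have "integrable lborel (\<lambda>x. indicator K x *\<^sub>R g x)"
    using assms(1,2) by (intro borel_integrable_compact) (auto intro: continuous_on_subset)
  ultimately show ?thesis by simp
qed

lemma has_derivative_outside_support: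
  fixes f :: "'a::real_normed_vector \<Rightarrow> 'b::real_normed_vector"
  assumes "(f has_derivative D) (at x)" "closed K" "\<And>x. x \<notin> K \<Longrightarrow> f x = 0" "x \<notin> K"
  shows "D = (\<lambda>h. 0)"
proof -
  have "((\<lambda>x. 0) has_derivative D) (at x)"
    by (rule has_derivative_transform_within_open[OF assms(1), of "- K"]) (use assms in auto)
  moreover have "((\<lambda>x. 0) has_derivative (\<lambda>h. 0)) (at x)" by simp
  ultimately show ?thesis by (rule has_derivative_unique)
qed

lemma integral_lborel_translate:
  fixes f :: "'a::euclidean_space \<Rightarrow> 'b::euclidean_space"
  assumes "f \<in> borel_measurable borel"
  shows "(LINT x|lborel. f (c + x)) = (LINT x|lborel. f x)"
  using integral_distr[of "(+) c" lborel borel f] assms by (simp add: lborel_distr_plus)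

text \<open>
  The integrals of the difference quotients vanish by translation invariance.
\<close>
lemma integral_directional_derivative_eq_0:
  fixes f :: "'a::euclidean_space \<Rightarrow> real"
  assumes D: "\<And>x. (f has_derivative D x) (at x)" and cont: "continuous_on UNIV (\<lambda>x. D x b)"
    and K: "compact K" and supp: "\<And>x. x \<notin> K \<Longrightarrow> f x = 0"
  shows "(LINT x|lborel. D x b) = 0"
proof -
  have D0: "D x b = 0" if "x \<notin> K" for x
    using has_derivative_outside_support[OF D compact_imp_closed[OF K] supp that] by simp
  have "bounded ((\<lambda>x. D x b) ` K)"
    using compact_continuous_image[OF continuous_on_subset[OF cont] K] compact_imp_bounded by blast
  then obtain M where M: "\<And>x. x \<in> K \<Longrightarrow> \<bar>D x b\<bar> \<le> M" "M > 0"
    unfolding bounded_pos by auto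
  have M: "\<bar>D x b\<bar> \<le> M" for x
    using M D0[of x] by (cases "x \<in> K") auto
  obtain R where R: "\<And>x. x \<in> K \<Longrightarrow> norm x \<le> R"
    using compact_imp_bounded[OF K] unfolding bounded_iff by blast
  define t :: "nat \<Rightarrow> real" where "t n = inverse (real (Suc n))" for n
  have t: "0 < t n" "t n \<le> 1" for n
    by (auto simp: t_def inverse_eq_divide)
  define q where "q n x = (f (t n *\<^sub>R b + x) - f x) / t n" for n x
  have line: "((\<lambda>s. f (s *\<^sub>R b + x)) has_real_derivative D (s *\<^sub>R b + x) b) (at s)" for s x
  proof -
    interpret bounded_linear "D (s *\<^sub>R b + x)" using D by (rule has_derivative_bounded_linear)
    have "((\<lambda>s. s *\<^sub>R b + x) has_derivative (\<lambda>h. h *\<^sub>R b)) (at s)"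
      by (auto intro!: derivative_eq_intros)
    from has_derivative_compose[OF this D] show ?thesis
      by (simp add: has_field_derivative_def scaleR mult.commute[of _ "D _ b"] cong: if_cong)
  qed
  have f_cont: "continuous_on UNIV f"
    using D by (rule has_derivative_continuous_on)
  have f_int: "integrable lborel f"
    by (rule integrable_continuous_compact_support[OF f_cont K supp])
  have f_meas: "f \<in> borel_measurable borel"
    by (rule borel_measurable_continuous_onI[OF f_cont])
  have "integrable lborel (\<lambda>x. f (c + x))" for c
  proof -
    have "integrable (distr lborel borel ((+) c)) f" using f_int by (simp add: lborel_distr_plus)
    then show ?thesis by (subst (asm) integrable_distr_eq) (use f_meas in auto)
  qed
  then have q0: "(LINT x|lborel. q n x) = 0" for n
    using f_int unfolding q_def by (simp add: integral_lborel_translate[OF f_meas])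
  have "(\<lambda>n. LINT x|lborel. q n x) \<longlonglongrightarrow> (LINT x|lborel. D x b)"
  \<comment> \<open>Since \<open>t n \<le> 1\<close>, all difference quotients vanish outside the
    ball of radius \<open>R + norm b\<close>. On the ball the mean value theorem bounds them by
    \<open>M\<close>.\<close>
  proof (rule integral_dominated_convergence[where w = "\<lambda>x. indicator (cball 0 (R + norm b)) x *\<^sub>R M"])
    show "(\<lambda>x. D x b) \<in> borel_measurable lborel"
      using borel_measurable_continuous_onI[OF cont] by simp
    show "q n \<in> borel_measurable lborel" for n
      unfolding q_def using f_meas by measurable
    show "integrable lborel (\<lambda>x::'a. indicat_real (cball 0 (R + norm b)) x *\<^sub>R M)"
      by (rule borel_integrable_compact) auto
    show "AE x in lborel. (\<lambda>n. q n x) \<longlonglongrightarrow> D x b"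
    proof (rule AE_I2)
      fix x
      have "((\<lambda>h. (f (h *\<^sub>R b + x) - f x) / h) \<longlongrightarrow> D x b) (at 0)"
        using line[of x 0] by (simp add: DERIV_def)
      moreover have "filterlim t (at 0) sequentially"
        using t LIMSEQ_inverse_real_of_nat
        by (auto simp: filterlim_at t_def[abs_def] intro!: always_eventually)
      ultimately show "(\<lambda>n. q n x) \<longlonglongrightarrow> D x b"
        unfolding q_def by (rule filterlim_compose)
    qed
    show "AE x in lborel. norm (q n x) \<le> indicat_real (cball 0 (R + norm b)) x *\<^sub>R M" for n
    proof (rule AE_I2)
      fix x :: 'a
      obtain s where "f (t n *\<^sub>R b + x) - f (0 *\<^sub>R b + x) = (t n - 0) * D (s *\<^sub>R b + x) b"
        using MVT2[OF t(1)[of n], of "\<lambda>s. f (s *\<^sub>R b + x)" "\<lambda>s. D (s *\<^sub>R b + x) b"] line by blast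
      then have "q n x = D (s *\<^sub>R b + x) b" using t(1)[of n] by (simp add: q_def)
      then have "\<bar>q n x\<bar> \<le> M" using M by simp
      moreover have "q n x = 0" if x: "x \<notin> cball 0 (R + norm b)"
      proof -
        have "norm (t n *\<^sub>R b) \<le> norm b"
          using t[of n] by (simp add: mult_left_le_one_le)
        moreover have "norm x \<le> norm (t n *\<^sub>R b) + norm (t n *\<^sub>R b + x)"
          using norm_triangle_ineq4[of "t n *\<^sub>R b + x" "t n *\<^sub>R b"] by simp
        ultimately have "t n *\<^sub>R b + x \<notin> K" "x \<notin> K"
          using x R[of x] R[of "t n *\<^sub>R b + x"] norm_ge_zero[of b] by (auto simp del: norm_scaleR)
        then show ?thesis by (simp add: q_def supp)
      qed
      ultimately show "norm (q n x) \<le> indicat_real (cball 0 (R + norm b)) x *\<^sub>R M"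
        by (cases "x \<in> cball 0 (R + norm b)") auto
    qed
  qed
  then show ?thesis unfolding q0 by (simp add: LIMSEQ_const_iff)
qed


section \<open>Test functions and the spaces \<open>L1\<close> and \<open>Linf\<close>\<close>

lemma test_function_props:
  fixes \<phi> :: "'a::euclidean_space \<Rightarrow> real"
  assumes "\<phi> \<in> test_functions \<Omega>"
  shows "(\<phi> has_derivative frechet_derivative \<phi> (at x)) (at x)"
    and "continuous_on UNIV \<phi>"
    and "b \<in> Basis \<Longrightarrow> continuous_on UNIV (\<lambda>x. frechet_derivative \<phi> (at x) b)"
    and "compact (closure {x. \<phi> x \<noteq> 0})"
    and "closure {x. \<phi> x \<noteq> 0} \<subseteq> \<Omega>"
    and "x \<notin> closure {x. \<phi> x \<noteq> 0} \<Longrightarrow> \<phi> x = 0"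
    and "x \<notin> closure {x. \<phi> x \<noteq> 0} \<Longrightarrow> frechet_derivative \<phi> (at x) b = 0"
proof -
  have Ck: "Ck k \<phi>" for k using assms by (simp add: test_functions_def)
  show D: "(\<phi> has_derivative frechet_derivative \<phi> (at x)) (at x)" for x
    using Ck[of 1] by (simp add: frechet_derivative_works)
  show "continuous_on UNIV \<phi>" using Ck[of 0] by simp
  show "continuous_on UNIV (\<lambda>x. frechet_derivative \<phi> (at x) b)" if "b \<in> Basis"
    using Ck[of 1] that by simp
  show "compact (closure {x. \<phi> x \<noteq> 0})" "closure {x. \<phi> x \<noteq> 0} \<subseteq> \<Omega>"
    using assms by (simp_all add: test_functions_def)
  have supp: "\<phi> x = 0" if "x \<notin> closure {x. \<phi> x \<noteq> 0}" for x
    using that closure_subset[of "{x. \<phi> x \<noteq> 0}"] by blast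
  then show "\<phi> x = 0" if "x \<notin> closure {x. \<phi> x \<noteq> 0}" using that .
  show "frechet_derivative \<phi> (at x) b = 0" if "x \<notin> closure {x. \<phi> x \<noteq> 0}"
    using has_derivative_outside_support[OF D closed_closure supp that] by simp
qed

lemma L1_integrable_lborel:
  assumes "integrable lborel g" "\<Omega> \<in> sets lebesgue"
  shows "g \<in> L1 \<Omega>"
proof -
  have "integrable lebesgue g" using assms(1) by (simp add: integrable_completion borel_measurable_integrable)
  then show ?thesis
    using assms(2) integrable_mult_indicator[of \<Omega> lebesgue g]
    by (simp add: L1_def integrable_restrict_space)
qed

text \<open>Makes both sides of the weak gradient identity pairings of \<open>Linf\<close> with
  \<open>L1\<close>.\<close>

lemma test_function_L1:
  assumes "\<phi> \<in> test_functions \<Omega>" "\<Omega> \<in> sets lebesgue"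
  shows "\<phi> \<in> L1 \<Omega>" and "b \<in> Basis \<Longrightarrow> (\<lambda>x. frechet_derivative \<phi> (at x) b) \<in> L1 \<Omega>"
proof -
  note props = test_function_props[OF assms(1)]
  show "\<phi> \<in> L1 \<Omega>"
    by (rule L1_integrable_lborel[OF integrable_continuous_compact_support[OF props(2,4)] assms(2)])
      (rule props(6))
  show "(\<lambda>x. frechet_derivative \<phi> (at x) b) \<in> L1 \<Omega>" if "b \<in> Basis"
    by (rule L1_integrable_lborel[OF integrable_continuous_compact_support[OF props(3)[OF that] props(4)] assms(2)])
      (rule props(7))
qed

lemma integrable_Linf_inner_L1:
  assumes f: "f \<in> Linf \<Omega>" and g: "g \<in> L1 \<Omega>"
  shows "integrable (lebesgue_on \<Omega>) (\<lambda>x. f x \<bullet> g x)"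
proof -
  obtain M where M: "AE x in lebesgue_on \<Omega>. norm (f x) \<le> M"
    and fm: "f \<in> borel_measurable (lebesgue_on \<Omega>)" using f by (auto simp: Linf_def)
  have gi: "integrable (lebesgue_on \<Omega>) g" using g by (simp add: L1_def)
  show ?thesis
  proof (rule Bochner_Integration.integrable_bound)
    show "integrable (lebesgue_on \<Omega>) (\<lambda>x. M * norm (g x))" using gi by simp
    show "(\<lambda>x. f x \<bullet> g x) \<in> borel_measurable (lebesgue_on \<Omega>)"
      by (rule borel_measurable_inner[OF fm borel_measurable_integrable[OF gi]])
    show "AE x in lebesgue_on \<Omega>. norm (f x \<bullet> g x) \<le> norm (M * norm (g x))"
      using M
    proof eventually_elim
      case (elim x)
      have "\<bar>f x \<bullet> g x\<bar> \<le> norm (f x) * norm (g x)" by (rule Cauchy_Schwarz_ineq2)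
      also have "\<dots> \<le> M * norm (g x)" by (rule mult_right_mono[OF elim norm_ge_zero])
      finally show ?case by simp
    qed
  qed
qed

text \<open>Applied to scalings and to the coordinate projections of vectors and matrices.\<close>

lemma Linf_bounded_linear:
  assumes "bounded_linear T" "f \<in> Linf \<Omega>"
  shows "(\<lambda>x. T (f x)) \<in> Linf \<Omega>"
proof -
  interpret bounded_linear T by fact
  obtain B where B: "\<And>x. norm (T x) \<le> norm x * B" "B \<ge> 0"
    using nonneg_bounded by blast
  obtain M where M: "AE x in lebesgue_on \<Omega>. norm (f x) \<le> M"
    using assms(2) by (auto simp: Linf_def)
  then have "AE x in lebesgue_on \<Omega>. norm (T (f x)) \<le> M * B"
    by (rule eventually_mono) (rule order_trans[OF B(1) mult_right_mono[OF _ B(2)]])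
  moreover have "(\<lambda>x. T (f x)) \<in> borel_measurable (lebesgue_on \<Omega>)"
    using borel_measurable_continuous_on[OF linear_continuous_on[OF assms(1)], of f] assms(2)
    by (simp add: Linf_def)
  ultimately show ?thesis by (auto simp: Linf_def)
qed

lemma Linf_add:
  assumes "f \<in> Linf \<Omega>" "g \<in> Linf \<Omega>"
  shows "(\<lambda>x. f x + g x) \<in> Linf \<Omega>"
proof -
  obtain M N where "AE x in lebesgue_on \<Omega>. norm (f x) \<le> M" "AE x in lebesgue_on \<Omega>. norm (g x) \<le> N"
    using assms by (auto simp: Linf_def)
  then have "AE x in lebesgue_on \<Omega>. norm (f x + g x) \<le> M + N"
    by eventually_elim (rule norm_triangle_mono)
  with assms show ?thesis by (auto simp: Linf_def intro!: borel_measurable_add)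
qed

lemma Linf_scaleR: "f \<in> Linf \<Omega> \<Longrightarrow> (\<lambda>x. c *\<^sub>R f x) \<in> Linf \<Omega>"
  by (rule Linf_bounded_linear[OF bounded_linear_scaleR_right])

lemma Linf_continuous:
  assumes "continuous_on UNIV f" "bounded \<Omega>"
  shows "f \<in> Linf \<Omega>"
proof -
  have "compact (f ` closure \<Omega>)"
    using assms by (intro compact_continuous_image continuous_on_subset[OF assms(1)]) (simp_all add: compact_closure)
  from compact_imp_bounded[OF this] obtain M where "\<forall>y\<in>f ` closure \<Omega>. norm y \<le> M"
    unfolding bounded_iff ..
  then have "AE x in lebesgue_on \<Omega>. norm (f x) \<le> M"
    using closure_subset by (intro AE_I2) auto
  moreover have "f \<in> borel_measurable (lebesgue_on \<Omega>)"
    using borel_measurable_continuous_onI[OF assms(1)]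
    by (intro measurable_restrict_space1 measurable_completion) simp
  ultimately show ?thesis by (auto simp: Linf_def)
qed

lemma Linf_subset_L1:
  assumes "open \<Omega>" "bounded \<Omega>"
  shows "Linf \<Omega> \<subseteq> L1 \<Omega>"
proof
  fix f :: "'a \<Rightarrow> 'b"
  assume "f \<in> Linf \<Omega>"
  then obtain M where "AE x in lebesgue_on \<Omega>. norm (f x) \<le> M" "f \<in> borel_measurable (lebesgue_on \<Omega>)"
    by (auto simp: Linf_def)
  moreover have "finite_measure (lebesgue_on \<Omega>)"
    using assms by (intro finite_measure_lebesgue_on) (simp add: bounded_set_imp_lmeasurable)
  ultimately show "f \<in> L1 \<Omega>"
    by (auto simp: L1_def intro: finite_measure.integrable_const_bound)
qed

section \<open>Weak gradients: linearity, uniqueness and linear maps\<close>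

text \<open>The \<open>Linf\<close> hypotheses make every integral involved a convergent one, so
  that the integrals of the sums split.\<close>

lemma has_weak_gradient_linear_combination:
  fixes u v :: "real^'n \<Rightarrow> real^'d"
  assumes \<Omega>: "open \<Omega>" and L: "u \<in> Linf \<Omega>" "v \<in> Linf \<Omega>" "G \<in> Linf \<Omega>" "H \<in> Linf \<Omega>"
    and u: "has_weak_gradient \<Omega> u G" and v: "has_weak_gradient \<Omega> v H"
  shows "has_weak_gradient \<Omega> (\<lambda>x. a *\<^sub>R u x + b *\<^sub>R v x) (\<lambda>x. a *\<^sub>R G x + b *\<^sub>R H x)"
  unfolding has_weak_gradient_def
proof (intro ballI allI)
  fix \<phi> and i :: 'd and j :: 'n
  assume \<phi>: "\<phi> \<in> test_functions \<Omega>"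
  let ?D = "\<lambda>x. frechet_derivative \<phi> (at x) (axis j 1)"
  have \<Omega>_sets: "\<Omega> \<in> sets lebesgue" using \<Omega> by auto
  have \<phi>1: "\<phi> \<in> L1 \<Omega>" and D1: "?D \<in> L1 \<Omega>"
    using test_function_L1[OF \<phi> \<Omega>_sets] by auto
  have comp: "integrable (lebesgue_on \<Omega>) (\<lambda>x. w x $ i * g x)"
    if "w \<in> Linf \<Omega>" "g \<in> L1 \<Omega>" for w :: "real^'n \<Rightarrow> real^'d" and g
    using integrable_Linf_inner_L1[OF Linf_bounded_linear[OF bounded_linear_vec_nth that(1)] that(2)]
    by simp
  have comp2: "integrable (lebesgue_on \<Omega>) (\<lambda>x. w x $ i $ j * g x)"
    if "w \<in> Linf \<Omega>" "g \<in> L1 \<Omega>" for w :: "real^'n \<Rightarrow> real^'n^'d" and g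
    using integrable_Linf_inner_L1[OF Linf_bounded_linear[OF bounded_linear_compose[OF bounded_linear_vec_nth bounded_linear_vec_nth] that(1)] that(2)]
    by simp
  have "(LINT x|lebesgue_on \<Omega>. (a *\<^sub>R u x + b *\<^sub>R v x) $ i * ?D x)
      = (LINT x|lebesgue_on \<Omega>. a * (u x $ i * ?D x) + b * (v x $ i * ?D x))"
    by (intro Bochner_Integration.integral_cong) (auto simp: algebra_simps)
  also have "\<dots> = a * (LINT x|lebesgue_on \<Omega>. u x $ i * ?D x) + b * (LINT x|lebesgue_on \<Omega>. v x $ i * ?D x)"
    using comp[OF L(1) D1] comp[OF L(2) D1] by simp
  also have "\<dots> = - (a * (LINT x|lebesgue_on \<Omega>. G x $ i $ j * \<phi> x) + b * (LINT x|lebesgue_on \<Omega>. H x $ i $ j * \<phi> x))"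
    using u v \<phi> unfolding has_weak_gradient_def by simp
  also have "\<dots> = - (LINT x|lebesgue_on \<Omega>. a * (G x $ i $ j * \<phi> x) + b * (H x $ i $ j * \<phi> x))"
    using comp2[OF L(3) \<phi>1] comp2[OF L(4) \<phi>1] by simp
  also have "\<dots> = - (LINT x|lebesgue_on \<Omega>. (a *\<^sub>R G x + b *\<^sub>R H x) $ i $ j * \<phi> x)"
    by (intro arg_cong[of _ _ uminus] Bochner_Integration.integral_cong) (auto simp: algebra_simps)
  finally show "(LINT x|lebesgue_on \<Omega>. (a *\<^sub>R u x + b *\<^sub>R v x) $ i * ?D x)
      = - (LINT x|lebesgue_on \<Omega>. (a *\<^sub>R G x + b *\<^sub>R H x) $ i $ j * \<phi> x)" .
qed

text \<open>The difference \<open>G - H\<close> is a weak gradient of \<open>u - u = 0\<close>, so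
  each of its finitely many entries is orthogonal to all test functions. The difference is written
  with coefficients 1 and -1 to fit the preceding lemma.\<close>

lemma has_weak_gradient_unique:
  fixes u :: "real^'n \<Rightarrow> real^'d"
  assumes \<Omega>: "open \<Omega>" "bounded \<Omega>" and L: "u \<in> Linf \<Omega>" "G \<in> Linf \<Omega>" "H \<in> Linf \<Omega>"
    and u: "has_weak_gradient \<Omega> u G" "has_weak_gradient \<Omega> u H"
  shows "AE x in lebesgue_on \<Omega>. G x = H x"
proof -
  define F where "F x = 1 *\<^sub>R G x + (- 1) *\<^sub>R H x" for x
  have F: "F \<in> Linf \<Omega>"
    unfolding F_def by (intro Linf_add Linf_scaleR L)
  have "has_weak_gradient \<Omega> (\<lambda>x. 1 *\<^sub>R u x + (- 1) *\<^sub>R u x) F"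
    using has_weak_gradient_linear_combination[OF \<Omega>(1) L(1,1,2,3) u] unfolding F_def .
  then have F0: "(LINT x|lebesgue_on \<Omega>. F x $ i $ j * \<phi> x) = 0" if "\<phi> \<in> test_functions \<Omega>" for \<phi> i j
    using that by (simp add: has_weak_gradient_def)
  have "AE x in lebesgue_on \<Omega>. F x $ i $ j = 0" for i j
  proof (rule fundamental_lemma_calculus_of_variations[OF \<Omega>(1)])
    have "(\<lambda>x. F x $ i $ j) \<in> Linf \<Omega>"
      by (rule Linf_bounded_linear[OF bounded_linear_compose[OF bounded_linear_vec_nth bounded_linear_vec_nth] F])
    then show "integrable (lebesgue_on \<Omega>) (\<lambda>x. F x $ i $ j)"
      using Linf_subset_L1[OF \<Omega>] unfolding L1_def by blast
  qed (rule F0)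
  then have "AE x in lebesgue_on \<Omega>. \<forall>i j. F x $ i $ j = 0"
    by (simp add: eventually_all_finite)
  then show ?thesis
    by (rule eventually_mono) (simp add: F_def vec_eq_iff)
qed

text \<open>Integration by parts for a linear function \<open>p\<close>: the product of
  \<open>p\<close> and the test function has compact support, so its derivative in direction
  \<open>axis j 1\<close> integrates to 0 over the whole space, and the product rule splits that
  derivative into the two sides.\<close>

lemma has_weak_gradient_matrix:
  fixes A :: "real^'n^'d"
  assumes \<Omega>: "open \<Omega>" "bounded \<Omega>"
  shows "has_weak_gradient \<Omega> (\<lambda>x. A *v x) (\<lambda>x. A)"
  unfolding has_weak_gradient_def
proof (intro ballI allI)
  fix \<phi> and i :: 'd and j :: 'n
  assume \<phi>: "\<phi> \<in> test_functions \<Omega>"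
  note props = test_function_props[OF \<phi>]
  define D where "D x = frechet_derivative \<phi> (at x)" for x
  have D: "(\<phi> has_derivative D x) (at x)" for x
    unfolding D_def by (rule props(1))
  let ?e = "axis j (1::real) :: real^'n"
  have e: "?e \<in> Basis" by (simp add: axis_in_Basis_iff)
  have \<Omega>_sets: "\<Omega> \<inter> space lebesgue \<in> sets lebesgue" using \<Omega>(1) by auto
  have bl: "bounded_linear (\<lambda>x. (A *v x) $ i)"
    by (rule bounded_linear_compose[OF bounded_linear_vec_nth matrix_vector_mul_bounded_linear])
  define p where "p x = (A *v x) $ i" for x
  have p_cont: "continuous_on UNIV p"
    unfolding p_def by (rule linear_continuous_on[OF bl])
  have p_e: "p ?e = A $ i $ j"
    by (simp add: p_def matrix_vector_mul_component inner_axis)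
  define T where "T x h = p x * D x h + p h * \<phi> x" for x h
  have T: "((\<lambda>x. p x * \<phi> x) has_derivative T x) (at x)" for x
    unfolding T_def p_def by (rule has_derivative_mult[OF bounded_linear_imp_has_derivative[OF bl] D])
  have D_cont: "continuous_on UNIV (\<lambda>x. D x ?e)"
    unfolding D_def by (rule props(3)[OF e])
  have T_cont: "continuous_on UNIV (\<lambda>x. T x ?e)"
    unfolding T_def by (intro continuous_intros p_cont D_cont props(2))
  \<comment> \<open>The support of the test function lies in \<Omega>, so integrating over \<Omega>
    or over the whole space is the same.\<close>
  have out: "T x ?e = 0" if "x \<notin> \<Omega>" for x
  proof -
    note x = contra_subsetD[OF props(5) that]
    show ?thesis unfolding T_def D_def props(6)[OF x] props(7)[OF x] by simp
  qed
  have "(LINT x|lebesgue_on \<Omega>. T x ?e) = (LINT x|lebesgue. indicator \<Omega> x *\<^sub>R T x ?e)"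
    by (rule integral_restrict_space[OF \<Omega>_sets])
  also have "\<dots> = (LINT x|lebesgue. T x ?e)"
    by (rule Bochner_Integration.integral_cong) (auto simp: indicator_def out)
  also have "\<dots> = (LINT x|lborel. T x ?e)"
    using borel_measurable_continuous_onI[OF T_cont] by (simp add: integral_completion)
  also have "\<dots> = 0"
    by (rule integral_directional_derivative_eq_0[OF T T_cont props(4)]) (use props(6) in \<open>metis mult_zero_right\<close>)
  finally have "(LINT x|lebesgue_on \<Omega>. p x * D x ?e + A $ i $ j * \<phi> x) = 0"
    by (simp add: T_def p_e)
  moreover have "integrable (lebesgue_on \<Omega>) (\<lambda>x. p x * D x ?e)"
    using integrable_Linf_inner_L1[OF Linf_continuous[OF p_cont \<Omega>(2)] test_function_L1(2)[OF \<phi> _ e]] \<Omega>_sets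
    by (simp add: D_def)
  moreover have "integrable (lebesgue_on \<Omega>) (\<lambda>x. A $ i $ j * \<phi> x)"
    using test_function_L1(1)[OF \<phi>] \<Omega>_sets by (simp add: L1_def)
  ultimately show "(LINT x|lebesgue_on \<Omega>. (A *v x) $ i * frechet_derivative \<phi> (at x) ?e)
      = - (LINT x|lebesgue_on \<Omega>. A $ i $ j * \<phi> x)"
    by (simp add: p_def D_def)
qed

lemma weak_grad:
  assumes "u \<in> W1inf \<Omega>"
  shows "weak_grad \<Omega> u \<in> Linf \<Omega>" "has_weak_gradient \<Omega> u (weak_grad \<Omega> u)"
  using someI_ex[of "\<lambda>G. G \<in> Linf \<Omega> \<and> has_weak_gradient \<Omega> u G"] assms
  unfolding weak_grad_def W1inf_def by blast+

text \<open>Any explicit candidate for the gradient may thus replace the representative fixed by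
  choice, up to a null set.\<close>

lemma weak_grad_eq:
  assumes "open \<Omega>" "bounded \<Omega>" "u \<in> Linf \<Omega>" "G \<in> Linf \<Omega>" "has_weak_gradient \<Omega> u G"
  shows "u \<in> W1inf \<Omega>" "AE x in lebesgue_on \<Omega>. weak_grad \<Omega> u x = G x"
proof -
  show u: "u \<in> W1inf \<Omega>" using assms(3-5) unfolding W1inf_def by blast
  show "AE x in lebesgue_on \<Omega>. weak_grad \<Omega> u x = G x"
    by (rule has_weak_gradient_unique[OF assms(1-3) weak_grad(1)[OF u] assms(4) weak_grad(2)[OF u] assms(5)])
qed

lemma affine_perturbation_W1inf:
  fixes u :: "real^'n \<Rightarrow> real^'d" and A :: "real^'n^'d"
  assumes \<Omega>: "open \<Omega>" "bounded \<Omega>" and u: "u \<in> W1inf \<Omega>"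
  defines "v t x \<equiv> (1 - t) *\<^sub>R u x + t *\<^sub>R (A *v x)"
  shows "v t \<in> W1inf \<Omega>"
    and "AE x in lebesgue_on \<Omega>. weak_grad \<Omega> (v t) x = (1 - t) *\<^sub>R weak_grad \<Omega> u x + t *\<^sub>R A"
proof -
  note G = weak_grad[OF u]
  have uL: "u \<in> Linf \<Omega>" using u by (simp add: W1inf_def)
  have lin: "(\<lambda>x. A *v x) \<in> Linf \<Omega>"
    by (rule Linf_continuous[OF linear_continuous_on[OF matrix_vector_mul_bounded_linear] \<Omega>(2)])
  have const: "(\<lambda>x. A) \<in> Linf \<Omega>" by (rule Linf_continuous[OF continuous_on_const \<Omega>(2)])
  have vL: "v t \<in> Linf \<Omega>"
    unfolding v_def by (intro Linf_add Linf_scaleR uL lin)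
  have GL: "(\<lambda>x. (1 - t) *\<^sub>R weak_grad \<Omega> u x + t *\<^sub>R A) \<in> Linf \<Omega>"
    by (intro Linf_add Linf_scaleR G(1) const)
  have "has_weak_gradient \<Omega> (v t) (\<lambda>x. (1 - t) *\<^sub>R weak_grad \<Omega> u x + t *\<^sub>R A)"
    unfolding v_def
    by (rule has_weak_gradient_linear_combination[OF \<Omega>(1) uL lin G(1) const G(2) has_weak_gradient_matrix[OF \<Omega>]])
  from weak_grad_eq[OF \<Omega> vL GL this] show "v t \<in> W1inf \<Omega>"
    "AE x in lebesgue_on \<Omega>. weak_grad \<Omega> (v t) x = (1 - t) *\<^sub>R weak_grad \<Omega> u x + t *\<^sub>R A" .
qed

section \<open>Weak* topologies: continuous pairings and convergent sequences\<close>

lemma topspace_weak_star_Linf [simp]: "topspace (weak_star_Linf \<Omega>) = Linf \<Omega>"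
  by (auto simp: weak_star_Linf_def topspace_pullback_topology)

lemma continuous_map_weak_star_Linf_pairing:
  assumes "g \<in> L1 \<Omega>"
  shows "continuous_map (weak_star_Linf \<Omega>) euclideanreal (\<lambda>f. LINT x|lebesgue_on \<Omega>. f x \<bullet> g x)"
proof -
  have "continuous_map (weak_star_Linf \<Omega>) euclideanreal
      ((\<lambda>p. p g) \<circ> (\<lambda>f. \<lambda>g\<in>L1 \<Omega>. LINT x|lebesgue_on \<Omega>. f x \<bullet> g x))"
    unfolding weak_star_Linf_def
    by (rule continuous_map_pullback[OF continuous_map_product_projection[OF assms]])
  with assms show ?thesis by (simp add: comp_def)
qed

lemma limitin_pullback_topology:
  assumes "l \<in> A" "\<forall>\<^sub>F n in F. \<sigma> n \<in> A" "limitin T (f \<circ> \<sigma>) (f l) F"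
  shows "limitin (pullback_topology A f T) \<sigma> l F"
  unfolding limitin_def topspace_pullback_topology
proof (intro conjI allI impI)
  show "l \<in> f -` topspace T \<inter> A"
    using assms(1,3) by (simp add: limitin_def)
  fix U
  assume "openin (pullback_topology A f T) U \<and> l \<in> U"
  then obtain V where V: "openin T V" "U = f -` V \<inter> A" "f l \<in> V"
    by (auto simp: openin_pullback_topology)
  then have "\<forall>\<^sub>F n in F. (f \<circ> \<sigma>) n \<in> V"
    using assms(3) by (simp add: limitin_def)
  with assms(2) show "\<forall>\<^sub>F n in F. \<sigma> n \<in> U"
    by eventually_elim (simp add: V(2))
qed

text \<open>Limits in a pullback of a product topology are tested coordinatewise, and here the
  coordinates are the pairings.\<close>

lemma limitin_weak_star_Linf:
  assumes "l \<in> Linf \<Omega>" "\<And>n. \<sigma> n \<in> Linf \<Omega>"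
    and "\<And>g. g \<in> L1 \<Omega> \<Longrightarrow>
      ((\<lambda>n. LINT x|lebesgue_on \<Omega>. \<sigma> n x \<bullet> g x) \<longlongrightarrow> (LINT x|lebesgue_on \<Omega>. l x \<bullet> g x)) F"
  shows "limitin (weak_star_Linf \<Omega>) \<sigma> l F"
  unfolding weak_star_Linf_def
  by (rule limitin_pullback_topology)
    (use assms in \<open>auto simp: limitin_componentwise\<close>)

lemma topspace_weak_star_W1inf [simp]: "topspace (weak_star_W1inf \<Omega>) = W1inf \<Omega>"
  unfolding weak_star_W1inf_def topspace_pullback_topology
  using weak_grad(1) by (auto simp: W1inf_def)

lemma continuous_map_weak_star_W1inf_grad_pairing:
  assumes "g \<in> L1 \<Omega>"
  shows "continuous_map (weak_star_W1inf \<Omega>) euclideanreal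
    (\<lambda>u. LINT x|lebesgue_on \<Omega>. weak_grad \<Omega> u x \<bullet> g x)"
proof -
  have "continuous_map (prod_topology (weak_star_Linf \<Omega>) (weak_star_Linf \<Omega>)) euclideanreal
      ((\<lambda>f. LINT x|lebesgue_on \<Omega>. f x \<bullet> g x) \<circ> snd)"
    by (rule continuous_map_compose[OF continuous_map_snd continuous_map_weak_star_Linf_pairing[OF assms]])
  then have "continuous_map (weak_star_W1inf \<Omega>) euclideanreal
      (((\<lambda>f. LINT x|lebesgue_on \<Omega>. f x \<bullet> g x) \<circ> snd) \<circ> (\<lambda>u. (u, weak_grad \<Omega> u)))"
    unfolding weak_star_W1inf_def by (rule continuous_map_pullback)
  then show ?thesis by (simp add: comp_def)
qed

lemma limitin_weak_star_W1inf:
  assumes "l \<in> W1inf \<Omega>" "\<And>n. \<sigma> n \<in> W1inf \<Omega>"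
    and "limitin (weak_star_Linf \<Omega>) \<sigma> l F"
    and "limitin (weak_star_Linf \<Omega>) (\<lambda>n. weak_grad \<Omega> (\<sigma> n)) (weak_grad \<Omega> l) F"
  shows "limitin (weak_star_W1inf \<Omega>) \<sigma> l F"
  unfolding weak_star_W1inf_def
  by (rule limitin_pullback_topology)
    (use assms in \<open>auto simp: limitin_pairwise comp_def\<close>)

text \<open>Each pairing of \<open>\<sigma> n\<close> is affine in \<open>t n\<close>. The
  combination is only assumed almost everywhere because the lemma also serves for
  \<open>weak_grad\<close>, which is known only up to null sets.\<close>

lemma limitin_weak_star_Linf_convex_combination:
  fixes f h :: "'a::euclidean_space \<Rightarrow> 'b::euclidean_space"
  assumes L: "f \<in> Linf \<Omega>" "h \<in> Linf \<Omega>" "\<And>n. \<sigma> n \<in> Linf \<Omega>"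
    and \<sigma>: "\<And>n. AE x in lebesgue_on \<Omega>. \<sigma> n x = (1 - t n) *\<^sub>R f x + t n *\<^sub>R h x"
    and t: "t \<longlonglongrightarrow> 0"
  shows "limitin (weak_star_Linf \<Omega>) \<sigma> f sequentially"
proof (rule limitin_weak_star_Linf[OF L(1,3)])
  fix g :: "'a \<Rightarrow> 'b"
  assume g: "g \<in> L1 \<Omega>"
  let ?I = "\<lambda>f. LINT x|lebesgue_on \<Omega>. f x \<bullet> g x"
  note int = integrable_Linf_inner_L1[OF _ g]
  have "?I (\<sigma> n) = (1 - t n) * ?I f + t n * ?I h" for n
  proof -
    have "?I (\<sigma> n) = (LINT x|lebesgue_on \<Omega>. (1 - t n) * (f x \<bullet> g x) + t n * (h x \<bullet> g x))"
    proof (rule integral_cong_AE)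
      show "(\<lambda>x. \<sigma> n x \<bullet> g x) \<in> borel_measurable (lebesgue_on \<Omega>)"
        by (rule borel_measurable_integrable[OF int[OF L(3)]])
      show "(\<lambda>x. (1 - t n) * (f x \<bullet> g x) + t n * (h x \<bullet> g x)) \<in> borel_measurable (lebesgue_on \<Omega>)"
        using int[OF L(1)] int[OF L(2)] by (intro borel_measurable_integrable) simp
      show "AE x in lebesgue_on \<Omega>. \<sigma> n x \<bullet> g x = (1 - t n) * (f x \<bullet> g x) + t n * (h x \<bullet> g x)"
        using \<sigma>[of n] by eventually_elim (simp add: inner_simps)
    qed
    then show ?thesis using int[OF L(1)] int[OF L(2)] by simp
  qed
  moreover have "(\<lambda>n. (1 - t n) * ?I f + t n * ?I h) \<longlonglongrightarrow> (1 - 0) * ?I f + 0 * ?I h"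
    by (intro tendsto_intros t)
  ultimately show "(\<lambda>n. ?I (\<sigma> n)) \<longlonglongrightarrow> ?I f" by simp
qed

section \<open>Weak* lower semicontinuity of closed convex gradient constraints\<close>

text \<open>The integral is infinity times the measure of the set \<open>B\<close> where the
  constraint fails, and infinity times 0 is 0.\<close>

lemma constraint_functional_eq:
  assumes u: "u \<in> W1inf \<Omega>" and C: "C \<in> sets borel"
  shows "constraint_functional \<Omega> C u = (if AE x in lebesgue_on \<Omega>. weak_grad \<Omega> u x \<in> C then 0 else \<infinity>)"
proof -
  let ?M = "lebesgue_on \<Omega>"
  define B where "B = {x \<in> space ?M. weak_grad \<Omega> u x \<notin> C}"
  have "weak_grad \<Omega> u \<in> borel_measurable ?M"
    using weak_grad(1)[OF u] by (simp add: Linf_def)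
  then have "weak_grad \<Omega> u -` (- C) \<inter> space ?M \<in> sets ?M"
    by (rule measurable_sets) (use C in auto)
  then have B: "B \<in> sets ?M" by (simp add: B_def vimage_def Int_def conj_commute)
  have "(\<integral>\<^sup>+ x. indicator_inf C (weak_grad \<Omega> u x) \<partial>?M) = (\<integral>\<^sup>+ x. \<infinity> * indicator B x \<partial>?M)"
    by (rule nn_integral_cong) (simp add: indicator_inf_def B_def)
  also have "\<dots> = \<infinity> * emeasure ?M B"
    by (rule nn_integral_cmult_indicator[OF B])
  finally have eq: "constraint_functional \<Omega> C u = enn2ereal (\<infinity> * emeasure ?M B)"
    by (simp add: constraint_functional_def)
  have "(AE x in ?M. weak_grad \<Omega> u x \<in> C) \<longleftrightarrow> emeasure ?M B = 0"
    by (rule AE_iff_measurable[OF B]) (simp add: B_def)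
  then show ?thesis
    unfolding eq by (auto simp: ennreal_top_mult zero_ennreal.rep_eq)
qed

text \<open>
  The right-hand side only involves pairings of \<open>f\<close> with bounded functions, so it is a weak* closed
  condition on \<open>f\<close>.
\<close>
lemma (in finite_measure) AE_in_closed_convex_iff:
  fixes f :: "'a \<Rightarrow> 'b::euclidean_space"
  assumes f: "integrable M f" and S: "closed S" "convex S"
  shows "(AE x in M. f x \<in> S) \<longleftrightarrow>
    (\<forall>A\<in>sets M. \<forall>a b. (\<forall>y\<in>S. b \<le> a \<bullet> y) \<longrightarrow>
       b * measure M A \<le> (LINT x|M. f x \<bullet> (indicator A x *\<^sub>R a)))" (is "?L \<longleftrightarrow> ?R")
proof
  assume L: ?L
  show ?R
  proof (intro ballI allI impI)
    fix A a b
    assume A: "A \<in> sets M" and b: "\<forall>y\<in>S. b \<le> a \<bullet> y"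
    have "b * measure M A = (LINT x|M. indicator A x * b)"
      using A by (simp add: Int_absorb2 sets.sets_into_space)
    also have "\<dots> \<le> (LINT x|M. f x \<bullet> (indicator A x *\<^sub>R a))"
    proof (rule integral_mono_AE)
      show "integrable M (\<lambda>x. indicator A x * b)"
        using A by (simp add: emeasure_eq_measure)
      show "integrable M (\<lambda>x. f x \<bullet> (indicator A x *\<^sub>R a))"
        using integrable_inner_left[OF integrable_mult_indicator[OF A f], of a] by simp
      show "AE x in M. indicator A x * b \<le> f x \<bullet> (indicator A x *\<^sub>R a)"
        using L by eventually_elim (use b in \<open>auto simp: indicator_def inner_commute\<close>)
    qed
    finally show "b * measure M A \<le> (LINT x|M. f x \<bullet> (indicator A x *\<^sub>R a))" .
  qed
next
  assume R: ?R
  \<comment> \<open>A function whose averages over all sets of positive measure lie in a closed set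
    takes values there almost everywhere. An average outside \<open>S\<close> could be strictly
    separated from \<open>S\<close>, and the separating half-space contradicts the assumed
    inequality.\<close>
  show ?L
  proof (rule averaging_theorem[OF f S(1)])
    fix A
    assume A: "A \<in> sets M" "measure M A > 0"
    let ?avg = "(1 / measure M A) *\<^sub>R (LINT x:A|M. f x)"
    show "?avg \<in> S"
    proof (rule ccontr)
      assume "?avg \<notin> S"
      from separating_hyperplane_closed_point[OF S(2,1) this]
      obtain a b where ab: "a \<bullet> ?avg < b" "\<forall>y\<in>S. b < a \<bullet> y" by blast
      have "b * measure M A \<le> (LINT x|M. f x \<bullet> (indicator A x *\<^sub>R a))"
        using R A(1) ab(2) by (meson less_imp_le)
      also have "\<dots> = (LINT x|M. (indicator A x *\<^sub>R f x) \<bullet> a)" by simp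
      also have "\<dots> = (LINT x:A|M. f x) \<bullet> a"
        unfolding set_lebesgue_integral_def by (rule integral_inner_left) (rule integrable_mult_indicator[OF A(1) f])
      also have "\<dots> = (a \<bullet> ?avg) * measure M A"
        using A(2) by (simp add: inner_commute)
      also have "\<dots> < b * measure M A"
        using ab(1) A(2) by (rule mult_strict_right_mono)
      finally show False by simp
    qed
  qed
qed

text \<open>Each inequality of \<open>AE_in_closed_convex_iff\<close> defines the preimage
  \<open>K j\<close> of a closed half-line under a continuous pairing, and the constraint set is
  their intersection.\<close>

lemma closedin_weak_star_W1inf_convex_constraint:
  fixes S :: "(real^'n^'d) set"
  assumes \<Omega>: "open \<Omega>" "bounded \<Omega>" and S: "closed S" "convex S"
  shows "closedin (weak_star_W1inf \<Omega>) {u \<in> W1inf \<Omega>. AE x in lebesgue_on \<Omega>. weak_grad \<Omega> u x \<in> S}"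
proof -
  let ?M = "lebesgue_on \<Omega>"
  interpret finite_measure ?M
    using \<Omega> by (intro finite_measure_lebesgue_on) (simp add: bounded_set_imp_lmeasurable)
  define J where "J = {(A, a, b). A \<in> sets ?M \<and> (\<forall>y\<in>S. b \<le> a \<bullet> y)}"
  define K where "K = (\<lambda>(A, a, b). {u :: real^'n \<Rightarrow> real^'d. u \<in> topspace (weak_star_W1inf \<Omega>) \<and>
    (LINT x|?M. weak_grad \<Omega> u x \<bullet> (indicator A x *\<^sub>R a)) \<in> {b * measure ?M A..}})"
  have "closedin (weak_star_W1inf \<Omega>) (K j)" if "j \<in> J" for j
  proof -
    obtain A a b where j: "j = (A, a, b)" by (cases j)
    have "A \<in> sets ?M" using that by (simp add: J_def j)
    then have "(\<lambda>x. indicator A x *\<^sub>R a) \<in> L1 \<Omega>"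
      by (simp add: L1_def emeasure_eq_measure)
    then show ?thesis
      unfolding K_def j prod.case
      by (intro closedin_continuous_map_preimage[OF continuous_map_weak_star_W1inf_grad_pairing]) auto
  qed
  \<comment> \<open>A trivial inequality keeps the index set nonempty, so that the intersection
    stays inside \<open>W1inf \<Omega>\<close>.\<close>
  moreover have "({}, 0, 0) \<in> J" by (simp add: J_def)
  ultimately have "closedin (weak_star_W1inf \<Omega>) (\<Inter>(K ` J))"
    by (intro closedin_Inter) auto
  moreover have "{u \<in> W1inf \<Omega>. AE x in ?M. weak_grad \<Omega> u x \<in> S} = \<Inter>(K ` J)"
  proof -
    have int: "integrable ?M (weak_grad \<Omega> u)" if "u \<in> W1inf \<Omega>" for u :: "real^'n \<Rightarrow> real^'d"
      using Linf_subset_L1[OF \<Omega>] weak_grad(1)[OF that] by (auto simp: L1_def)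
    have "u \<in> \<Inter>(K ` J) \<longleftrightarrow> u \<in> W1inf \<Omega> \<and> (AE x in ?M. weak_grad \<Omega> u x \<in> S)" for u
    proof (cases "u \<in> W1inf \<Omega>")
      case True
      then show ?thesis
        unfolding AE_in_closed_convex_iff[OF int[OF True] S] by (auto simp: K_def J_def)
    next
      case False
      with \<open>({}, 0, 0) \<in> J\<close> show ?thesis by (force simp: K_def)
    qed
    then show ?thesis by blast
  qed
  ultimately show ?thesis by simp
qed

text \<open>Only the values 0 and infinity occur, so a strict superlevel set is the whole space, the
  complement of the closed constraint set, or empty.\<close>

lemma lsc_constraint_functional:
  fixes S :: "(real^'n^'d) set"
  assumes \<Omega>: "open \<Omega>" "bounded \<Omega>" and S: "closed S" "convex S"
  shows "lsc_on_topology (weak_star_W1inf \<Omega>) (constraint_functional \<Omega> S)"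
  unfolding lsc_on_topology_def
proof
  fix a :: ereal
  let ?T = "weak_star_W1inf \<Omega> :: (real^'n \<Rightarrow> real^'d) topology"
  let ?K = "{u \<in> W1inf \<Omega>. AE x in lebesgue_on \<Omega>. weak_grad \<Omega> u x \<in> S}"
  have val: "constraint_functional \<Omega> S u = (if u \<in> ?K then 0 else \<infinity>)" if "u \<in> W1inf \<Omega>" for u
    using that S(1) by (simp add: constraint_functional_eq)
  have open_compl: "openin ?T (topspace ?T - ?K)"
    using closedin_weak_star_W1inf_convex_constraint[OF \<Omega> S] by blast
  consider "a < 0" | "0 \<le> a" "a < \<infinity>" | "a = \<infinity>" by fastforce
  then show "openin ?T {u \<in> topspace ?T. a < constraint_functional \<Omega> S u}"
  proof cases
    case 1
    then have "{u \<in> topspace ?T. a < constraint_functional \<Omega> S u} = topspace ?T"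
      by (auto simp: val intro: less_trans)
    then show ?thesis by (simp only: openin_topspace)
  next
    case 2
    then have "{u \<in> topspace ?T. a < constraint_functional \<Omega> S u} = topspace ?T - ?K"
      by (auto simp: val)
    with open_compl show ?thesis by simp
  next
    case 3
    then show ?thesis by simp
  qed
qed

section \<open>Sequential lower semicontinuity and the two envelopes\<close>

text \<open>Closed sets are sequentially closed, so the sequential topology is finer and admits at
  least as many competitors in the envelope.\<close>

lemma lsc_on_sequential_topology:
  assumes "lsc_on_topology T G"
  shows "lsc_on_topology (sequential_topology T) G"
  unfolding lsc_on_topology_def topspace_sequential_topology
proof
  fix a
  let ?U = "{x \<in> topspace T. a < G x}"
  have "closedin T (topspace T - ?U)"
    using assms unfolding lsc_on_topology_def by blast
  then have "sequentially_closedin T (topspace T - ?U)"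
    unfolding sequentially_closedin_def
    by (auto dest: limitin_closedin[where S = "topspace T - ?U"] simp: image_subset_iff)
  then show "openin (sequential_topology T) ?U"
    by (auto simp: openin_sequential_topology)
qed

text \<open>Sublevel sets of \<open>G\<close> are sequentially closed, so an upper bound along a
  sequence passes to its limit.\<close>

lemma lsc_on_sequential_topology_limit_le:
  assumes G: "lsc_on_topology (sequential_topology T) G"
    and \<sigma>: "limitin T \<sigma> l sequentially" "\<And>n. \<sigma> n \<in> topspace T" "\<And>n. G (\<sigma> n) \<le> c"
  shows "G l \<le> c"
proof -
  have "openin (sequential_topology T) {x \<in> topspace T. c < G x}"
    using G unfolding lsc_on_topology_def by simp
  then have "sequentially_closedin T (topspace T - {x \<in> topspace T. c < G x})"
    by (simp add: openin_sequential_topology)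
  from sequentially_closedinD[OF this _ \<sigma>(1)] \<sigma>(2,3)
  have "l \<in> topspace T - {x \<in> topspace T. c < G x}" by (simp add: not_less)
  then show ?thesis by auto
qed

theorem corollary3p6:
  fixes \<Omega> :: "(real^'n) set" and C :: "(real^'n^'d) set" and u :: "real^'n \<Rightarrow> real^'d"
  assumes "open \<Omega>" and "bounded \<Omega>" and "lipschitz_boundary \<Omega>"
    and "convex C" and "C \<in> sets borel" and "interior C \<noteq> {}"
    and "u \<in> W1inf \<Omega>"
  shows "constraint_functional \<Omega> (closure C) u =
           Gamma_env (weak_star_W1inf \<Omega>) (constraint_functional \<Omega> C) u \<and>
         Gamma_env (weak_star_W1inf \<Omega>) (constraint_functional \<Omega> C) u =
           Gamma_env (sequential_topology (weak_star_W1inf \<Omega>)) (constraint_functional \<Omega> C) u"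
proof -
  let ?T = "weak_star_W1inf \<Omega> :: (real^'n \<Rightarrow> real^'d) topology"
  note \<Omega> = assms(1,2)
  have val: "constraint_functional \<Omega> S v = (if AE x in lebesgue_on \<Omega>. weak_grad \<Omega> v x \<in> S then 0 else \<infinity>)"
    if "S \<in> sets borel" "v \<in> W1inf \<Omega>" for S and v :: "real^'n \<Rightarrow> real^'d"
    using constraint_functional_eq[OF that(2,1)] .
  have le: "constraint_functional \<Omega> (closure C) v \<le> constraint_functional \<Omega> C v"
    if "v \<in> topspace ?T" for v
  proof -
    have "AE x in lebesgue_on \<Omega>. weak_grad \<Omega> v x \<in> closure C"
      if "AE x in lebesgue_on \<Omega>. weak_grad \<Omega> v x \<in> C"
      using that by (rule eventually_mono) (use closure_subset in blast)
    with that show ?thesis by (simp add: val assms(5))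
  qed
  \<comment> \<open>The functional of \<open>closure C\<close> is itself a competitor in the weak*
    envelope.\<close>
  have lower: "constraint_functional \<Omega> (closure C) u \<le> Gamma_env ?T (constraint_functional \<Omega> C) u"
    unfolding Gamma_env_def
    by (rule SUP_upper) (use le lsc_constraint_functional[OF \<Omega> closed_closure convex_closure[OF assms(4)]] in auto)
  have mid: "Gamma_env ?T (constraint_functional \<Omega> C) u
      \<le> Gamma_env (sequential_topology ?T) (constraint_functional \<Omega> C) u"
    unfolding Gamma_env_def topspace_sequential_topology
    by (rule SUP_subset_mono) (auto intro: lsc_on_sequential_topology)
  \<comment> \<open>Every sequential competitor is bounded at \<open>u\<close>. Only a
    \<open>u\<close> satisfying the closed constraint matters, since otherwise the right-hand side
    is infinite.\<close>
  have "G u \<le> constraint_functional \<Omega> (closure C) u"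
    if G: "lsc_on_topology (sequential_topology ?T) G" "\<And>v. v \<in> topspace ?T \<Longrightarrow> G v \<le> constraint_functional \<Omega> C v"
    for G
  proof (cases "AE x in lebesgue_on \<Omega>. weak_grad \<Omega> u x \<in> closure C")
    case False
    then show ?thesis by (simp add: val assms(7))
  next
    case True
    obtain A where A: "A \<in> interior C" using assms(6) by blast
    define t :: "nat \<Rightarrow> real" where "t n = inverse (real (Suc n))" for n
    have t: "0 < t n" "t n \<le> 1" for n by (auto simp: t_def inverse_eq_divide)
    have t0: "t \<longlonglongrightarrow> 0" unfolding t_def by (rule LIMSEQ_inverse_real_of_nat)
    \<comment> \<open>The linear map of an interior matrix \<open>A\<close> shifts the gradient
      towards \<open>A\<close> by the fraction \<open>t n\<close>.\<close>
    define \<sigma> where "\<sigma> n x = (1 - t n) *\<^sub>R u x + t n *\<^sub>R (A *v x)" for n x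
    have \<sigma>: "\<sigma> n \<in> W1inf \<Omega>"
      "AE x in lebesgue_on \<Omega>. weak_grad \<Omega> (\<sigma> n) x = (1 - t n) *\<^sub>R weak_grad \<Omega> u x + t n *\<^sub>R A" for n
      using affine_perturbation_W1inf[OF \<Omega> assms(7), of "t n" A] unfolding \<sigma>_def by auto
    have "limitin ?T \<sigma> u sequentially"
    proof (rule limitin_weak_star_W1inf[OF assms(7) \<sigma>(1)])
      show "limitin (weak_star_Linf \<Omega>) \<sigma> u sequentially"
      proof (rule limitin_weak_star_Linf_convex_combination[OF _ _ _ _ t0])
        show "(\<lambda>x. A *v x) \<in> Linf \<Omega>"
          by (rule Linf_continuous[OF linear_continuous_on[OF matrix_vector_mul_bounded_linear] \<Omega>(2)])
        show "u \<in> Linf \<Omega>" "\<sigma> n \<in> Linf \<Omega>" for n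
          using \<sigma>(1)[of n] assms(7) by (simp_all add: W1inf_def)
        show "AE x in lebesgue_on \<Omega>. \<sigma> n x = (1 - t n) *\<^sub>R u x + t n *\<^sub>R (A *v x)" for n
          by (simp add: \<sigma>_def)
      qed
      show "limitin (weak_star_Linf \<Omega>) (\<lambda>n. weak_grad \<Omega> (\<sigma> n)) (weak_grad \<Omega> u) sequentially"
        by (rule limitin_weak_star_Linf_convex_combination[OF weak_grad(1)[OF assms(7)]
              Linf_continuous[OF continuous_on_const \<Omega>(2)] weak_grad(1)[OF \<sigma>(1)] \<sigma>(2) t0])
    qed
    moreover have "G (\<sigma> n) \<le> 0" for n
    proof -
      have "AE x in lebesgue_on \<Omega>. weak_grad \<Omega> (\<sigma> n) x \<in> C"
        using True \<sigma>(2)[of n]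
      proof eventually_elim
        case (elim x)
        \<comment> \<open>Moving a point of the closure a positive fraction towards an interior
          point lands in the interior; this is why \<open>t n\<close> is never 0.\<close>
        have "weak_grad \<Omega> u x - t n *\<^sub>R (weak_grad \<Omega> u x - A) \<in> interior C"
          by (rule mem_interior_closure_convex_shrink[OF assms(4) A elim(1) t])
        also have "weak_grad \<Omega> u x - t n *\<^sub>R (weak_grad \<Omega> u x - A) = weak_grad \<Omega> (\<sigma> n) x"
          unfolding elim(2) by (simp add: algebra_simps)
        finally show ?case
          using interior_subset by blast
      qed
      then have "constraint_functional \<Omega> C (\<sigma> n) = 0" by (simp add: val assms(5) \<sigma>(1))
      with G(2)[of "\<sigma> n"] \<sigma>(1)[of n] show ?thesis by simp
    qed
    ultimately have "G u \<le> 0"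
      using lsc_on_sequential_topology_limit_le[OF G(1)] \<sigma>(1) by simp
    with True show ?thesis by (simp add: val assms(7))
  qed
  then have upper: "Gamma_env (sequential_topology ?T) (constraint_functional \<Omega> C) u
      \<le> constraint_functional \<Omega> (closure C) u"
    unfolding Gamma_env_def topspace_sequential_topology by (intro SUP_least) auto
  from lower mid upper show ?thesis by auto
qed

end
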